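(* Let $T$ be a unilateral weighted backward shift on $\ell^2(\mathbb N_0)$ with weight sequence $(a_i)_{i\ge1}$, and let $\delta>0$. If $$\lim_{n\to\infty}\prod_{i=1}^n|a_i|=\infty,$$ then $T$ is $\delta$-topologically mixing.
   Context: $\mathbb N_0=\{0,1,2,\dots\}$, and $\ell^2(\mathbb N_0)$ carries the metric $d$ induced by its usual norm; $(e_i)_{i\ge0}$ is its canonical basis. Given a bounded sequence $(a_i)_{i\ge1}$ of nonzero scalars, the unilateral weighted backward shift with weights $(a_i)$ is the bounded linear operator $T$ on $\ell^2(\mathbb N_0)$ determined by $T(e_i)=a_ie_{i-1}$ for $i\ge1$ and $T(e_0)=0$. A continuous map $f:M\to M$ on a metric space $(M,d)$ is $\delta$-topologically mixing if for every pair of nonempty open sets $U,V\subset M$ there exists $N\in\mathbb N$ such that $f^n(U)\cap B_\delta(V)\neq\varnothing$ for all $n\ge N$, where $B_\delta(V):=\{x\in M:\inf_{y\in V}d(x,y)<\delta\}$. *)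

theory Defs
  imports "HOL-Analysis.Analysis"
begin

text \<open>The scalars range over \<^class>\<open>real_normed_field\<close>. Its norm is multiplicative, so by
  Gelfand--Mazur its only members, up to isometric isomorphism, are the real and the complex field.\<close>

typedef (overloaded) ('a :: real_normed_field) ell2 =
  "{x :: nat \<Rightarrow> 'a. summable (\<lambda>i. (norm (x i))\<^sup>2)}"
  morphisms ell2_nth Abs_ell2
  by (rule exI[of _ "\<lambda>_. 0"]) simp

setup_lifting type_definition_ell2

lemma ell2_eqI: "(\<And>i. ell2_nth x i = ell2_nth y i) \<Longrightarrow> x = y"
  by (metis ell2_nth_inject ext)

lemma ell2_summable: "summable (\<lambda>i. (norm (ell2_nth x i))\<^sup>2)"
  using ell2_nth by blast

lemma ell2_partial_minkowski:
  fixes x y :: "nat \<Rightarrow> 'a :: real_normed_field"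
  assumes x: "summable (\<lambda>i. (norm (x i))\<^sup>2)" and y: "summable (\<lambda>i. (norm (y i))\<^sup>2)"
  shows "(\<Sum>i<n. (norm (x i + y i))\<^sup>2)
           \<le> (sqrt (\<Sum>i. (norm (x i))\<^sup>2) + sqrt (\<Sum>i. (norm (y i))\<^sup>2))\<^sup>2"
proof -
  have "sqrt (\<Sum>i<n. (norm (x i + y i))\<^sup>2) = L2_set (\<lambda>i. norm (x i + y i)) {..<n}"
    by (simp add: L2_set_def)
  also have "\<dots> \<le> L2_set (\<lambda>i. norm (x i) + norm (y i)) {..<n}"
    by (rule L2_set_mono) (auto simp: norm_triangle_ineq)
  also have "\<dots> \<le> L2_set (\<lambda>i. norm (x i)) {..<n} + L2_set (\<lambda>i. norm (y i)) {..<n}"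
    by (rule L2_set_triangle_ineq)
  also have "\<dots> \<le> sqrt (\<Sum>i. (norm (x i))\<^sup>2) + sqrt (\<Sum>i. (norm (y i))\<^sup>2)"
    unfolding L2_set_def
    by (intro add_mono real_sqrt_le_mono sum_le_suminf x y) auto
  finally show ?thesis
    by (rule real_sqrt_le_iff[THEN iffD1, OF order_trans])
       (simp add: suminf_nonneg x y)
qed

lemma ell2_summable_add:
  fixes x y :: "nat \<Rightarrow> 'a :: real_normed_field"
  assumes "summable (\<lambda>i. (norm (x i))\<^sup>2)" "summable (\<lambda>i. (norm (y i))\<^sup>2)"
  shows "summable (\<lambda>i. (norm (x i + y i))\<^sup>2)"
  by (rule summableI_nonneg_bounded[OF _ ell2_partial_minkowski[OF assms]]) simp

lemma ell2_summable_scale: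
  fixes x :: "nat \<Rightarrow> 'a :: real_normed_field"
  assumes "summable (\<lambda>i. (norm (x i))\<^sup>2)"
  shows "summable (\<lambda>i. (norm (c * x i))\<^sup>2)"
  using assms by (simp add: norm_mult power_mult_distrib summable_mult)

instantiation ell2 :: (real_normed_field) real_normed_vector
begin

lift_definition zero_ell2 :: "'a ell2" is "\<lambda>_. 0" by simp

lift_definition plus_ell2 :: "'a ell2 \<Rightarrow> 'a ell2 \<Rightarrow> 'a ell2" is "\<lambda>x y i. x i + y i"
  by (rule ell2_summable_add)

lift_definition uminus_ell2 :: "'a ell2 \<Rightarrow> 'a ell2" is "\<lambda>x i. - x i" by simp

lift_definition minus_ell2 :: "'a ell2 \<Rightarrow> 'a ell2 \<Rightarrow> 'a ell2" is "\<lambda>x y i. x i - y i"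
  using ell2_summable_add[of _ "\<lambda>i. - _ i"] by simp

lift_definition scaleR_ell2 :: "real \<Rightarrow> 'a ell2 \<Rightarrow> 'a ell2" is "\<lambda>r x i. r *\<^sub>R x i"
  by (simp add: power_mult_distrib summable_mult)

definition norm_ell2 :: "'a ell2 \<Rightarrow> real" where
  "norm_ell2 x = sqrt (\<Sum>i. (norm (ell2_nth x i))\<^sup>2)"

definition dist_ell2 :: "'a ell2 \<Rightarrow> 'a ell2 \<Rightarrow> real" where
  "dist_ell2 x y = norm (x - y)"

definition sgn_ell2 :: "'a ell2 \<Rightarrow> 'a ell2" where
  "sgn_ell2 x = inverse (norm x) *\<^sub>R x"

definition uniformity_ell2 :: "('a ell2 \<times> 'a ell2) filter" where
  "uniformity_ell2 = (INF e\<in>{0<..}. principal {(x, y). dist x y < e})"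

definition open_ell2 :: "'a ell2 set \<Rightarrow> bool" where
  "open_ell2 U = (\<forall>x\<in>U. \<forall>\<^sub>F (x', y) in uniformity. x' = x \<longrightarrow> y \<in> U)"

instance
proof
  fix x y z :: "'a ell2" and r s :: real
  show "x + y + z = x + (y + z)" by transfer (simp add: add.assoc)
  show "x + y = y + x" by transfer (simp add: add.commute)
  show "0 + x = x" by transfer simp
  show "- x + x = 0" by transfer simp
  show "x - y = x + - y" by transfer simp
  show "r *\<^sub>R (x + y) = r *\<^sub>R x + r *\<^sub>R y" by transfer (simp add: scaleR_add_right)
  show "(r + s) *\<^sub>R x = r *\<^sub>R x + s *\<^sub>R x" by transfer (simp add: scaleR_add_left)
  show "r *\<^sub>R s *\<^sub>R x = (r * s) *\<^sub>R x" by transfer simp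
  show "1 *\<^sub>R x = x" by transfer simp
  show "dist x y = norm (x - y)" by (rule dist_ell2_def)
  show "sgn x = inverse (norm x) *\<^sub>R x" by (rule sgn_ell2_def)
  show "uniformity = (INF e\<in>{0<..}. principal {(x, y :: 'a ell2). dist x y < e})"
    by (rule uniformity_ell2_def)
  show "open U = (\<forall>x\<in>U. \<forall>\<^sub>F (x', y) in uniformity. x' = x \<longrightarrow> y \<in> U)" for U :: "'a ell2 set"
    by (rule open_ell2_def)
  show "norm x = 0 \<longleftrightarrow> x = 0"
    using suminf_eq_zero_iff[OF ell2_summable[of x]]
    by (auto simp: norm_ell2_def zero_ell2.rep_eq intro: ell2_eqI)
  show "norm (x + y) \<le> norm x + norm y"
    unfolding norm_ell2_def plus_ell2.rep_eq
    by (intro real_le_lsqrt suminf_le_const ell2_summable_add ell2_partial_minkowski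
        ell2_summable add_nonneg_nonneg real_sqrt_ge_zero suminf_nonneg) auto
  show "norm (r *\<^sub>R x) = \<bar>r\<bar> * norm x"
    by (simp add: norm_ell2_def scaleR_ell2.rep_eq power_mult_distrib
        suminf_mult[OF ell2_summable] real_sqrt_mult)
qed

end

lift_definition ell2_scale :: "'a :: real_normed_field \<Rightarrow> 'a ell2 \<Rightarrow> 'a ell2" is "\<lambda>c x i. c * x i"
  by (rule ell2_summable_scale)

lift_definition ell2_basis :: "nat \<Rightarrow> ('a :: real_normed_field) ell2" is
  "\<lambda>j i. if i = j then 1 else 0"
proof -
  fix j :: nat
  show "summable (\<lambda>i. (norm (if i = j then 1 else 0 :: 'a))\<^sup>2)"
    by (rule summable_finite[of "{j}"]) auto
qed

text \<open>\<^const>\<open>bounded_linear\<close> only gives real linearity, which over the complex scalars would not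
  determine the operator from its values on the basis; hence the homogeneity clause. The value
  \<open>a 0\<close> is irrelevant, as the weights are indexed from 1.\<close>

definition weighted_backward_shift ::
    "(nat \<Rightarrow> 'a :: real_normed_field) \<Rightarrow> ('a ell2 \<Rightarrow> 'a ell2) \<Rightarrow> bool" where
  "weighted_backward_shift a T \<longleftrightarrow>
     bounded (a ` {1..}) \<and> (\<forall>i\<ge>1. a i \<noteq> 0) \<and>
     bounded_linear T \<and> (\<forall>c x. T (ell2_scale c x) = ell2_scale c (T x)) \<and>
     T (ell2_basis 0) = 0 \<and>
     (\<forall>i\<ge>1. T (ell2_basis i) = ell2_scale (a i) (ell2_basis (i - 1)))"

definition set_nbhd :: "real \<Rightarrow> 'm :: metric_space set \<Rightarrow> 'm set" where
  "set_nbhd \<delta> V = {x. infdist x V < \<delta>}"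

definition delta_topologically_mixing :: "real \<Rightarrow> ('m :: metric_space \<Rightarrow> 'm) \<Rightarrow> bool" where
  "delta_topologically_mixing \<delta> f \<longleftrightarrow>
     continuous_on UNIV f \<and>
     (\<forall>U V. open U \<and> U \<noteq> {} \<and> open V \<and> V \<noteq> {} \<longrightarrow>
        (\<exists>N. \<forall>n\<ge>N. (f ^^ n) ` U \<inter> set_nbhd \<delta> V \<noteq> {}))"

end

theory Submission
  imports Defs
begin

text \<open>
  The hypothesis makes \<open>T\<close> topologically mixing outright, for every \<open>\<delta> > 0\<close> at once, by Kitai's
  criterion (\<open>kitai_criterion\<close>) applied to the dense set of finitely supported vectors
  (\<open>closure_finitely_supported\<close>). Put \<open>W n = a 1 * \<dots> * a n\<close>. The power \<open>T ^^ n\<close> kills \<open>e\<^sub>k\<close> for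
  \<open>k < n\<close>, so orbits of finitely supported vectors are eventually zero. Moreover \<open>T ^^ n\<close> maps
  \<open>e\<^bsub>j + n\<^esub>\<close> to \<open>(W (j + n) / W j) e\<^sub>j\<close>, so \<open>(W j / W (j + n)) e\<^bsub>j + n\<^esub>\<close> is a preimage of \<open>e\<^sub>j\<close>
  under \<open>T ^^ n\<close>, and for fixed \<open>j\<close> it tends to zero because \<open>norm (W n)\<close> tends to infinity.
  Linear combinations give small preimages of every finitely supported vector.
\<close>

lemma ell2_nth_sum: "ell2_nth (\<Sum>j\<in>A. f j) i = (\<Sum>j\<in>A. ell2_nth (f j) i)"
  by (induction A rule: infinite_finite_induct) (simp_all add: zero_ell2.rep_eq plus_ell2.rep_eq)

lemma ell2_scale_scale: "ell2_scale c (ell2_scale d x) = ell2_scale (c * d) x"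
  by transfer (simp add: mult.assoc)

lemma ell2_scale_zero [simp]: "ell2_scale c 0 = 0"
  by transfer simp

lemma ell2_scale_one [simp]: "ell2_scale 1 x = x"
  by transfer simp

lemma norm_ell2_scale: "norm (ell2_scale c x) = norm c * norm x"
  by (simp add: norm_ell2_def ell2_scale.rep_eq norm_mult power_mult_distrib
      suminf_mult[OF ell2_summable] real_sqrt_mult)

lemma norm_ell2_basis [simp]: "norm (ell2_basis j :: 'a :: real_normed_field ell2) = 1"
proof -
  have "(\<Sum>i. (norm (ell2_nth (ell2_basis j :: 'a ell2) i))\<^sup>2)
      = (\<Sum>i\<in>{j}. (norm (ell2_nth (ell2_basis j :: 'a ell2) i))\<^sup>2)"
    by (rule suminf_finite) (auto simp: ell2_basis.rep_eq)
  then show ?thesis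
    by (simp add: norm_ell2_def ell2_basis.rep_eq)
qed

text \<open>The vector with coordinates \<open>c 0, \<dots>, c (m - 1), 0, 0, \<dots>\<close>. The coefficients are
  parametrised by a whole sequence \<open>c\<close>, of which only the first \<open>m\<close> entries matter, so that the
  truncations of \<open>x\<close> are simply \<open>ell2_finite_sum m (ell2_nth x)\<close>.\<close>

definition ell2_finite_sum :: "nat \<Rightarrow> (nat \<Rightarrow> 'a :: real_normed_field) \<Rightarrow> 'a ell2" where
  "ell2_finite_sum m c = (\<Sum>j<m. ell2_scale (c j) (ell2_basis j))"

lemma ell2_nth_finite_sum: "ell2_nth (ell2_finite_sum m c) i = (if i < m then c i else 0)"
  by (simp add: ell2_finite_sum_def ell2_nth_sum ell2_scale.rep_eq ell2_basis.rep_eq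
      if_distrib[of "\<lambda>x. _ * x"] sum.delta cong: if_cong)

lemma ell2_truncation_tendsto:
  fixes x :: "'a :: real_normed_field ell2"
  shows "(\<lambda>m. ell2_finite_sum m (ell2_nth x)) \<longlonglongrightarrow> x"
proof -
  define f where "f i = (norm (ell2_nth x i))\<^sup>2" for i
  have f: "summable f"
    unfolding f_def by (rule ell2_summable)
  have norm_eq: "norm (ell2_finite_sum m (ell2_nth x) - x) = sqrt (suminf f - sum f {..<m})" for m
  proof -
    define g where "g i = (norm (ell2_nth (ell2_finite_sum m (ell2_nth x) - x) i))\<^sup>2" for i
    have g: "g i = (if i < m then 0 else f i)" for i
      by (simp add: g_def f_def minus_ell2.rep_eq ell2_nth_finite_sum)
    have "summable g"
      unfolding g_def by (rule ell2_summable)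
    from suminf_split_initial_segment[OF this, of m]
    have "suminf g = (\<Sum>i. f (i + m))"
      by (simp add: g)
    also have "\<dots> = suminf f - sum f {..<m}"
      by (rule suminf_minus_initial_segment[OF f])
    finally show ?thesis
      unfolding norm_ell2_def g_def by simp
  qed
  have "(\<lambda>m. sqrt (suminf f - sum f {..<m})) \<longlonglongrightarrow> sqrt (suminf f - suminf f)"
    by (intro tendsto_intros summable_LIMSEQ f)
  then have "(\<lambda>m. ell2_finite_sum m (ell2_nth x) - x) \<longlonglongrightarrow> 0"
    using tendsto_norm_zero_cancel[of "\<lambda>m. ell2_finite_sum m (ell2_nth x) - x"]
    by (simp add: norm_eq)
  then show ?thesis
    by (rule LIM_zero_cancel)
qed

lemma closure_finitely_supported:
  "closure {ell2_finite_sum m c | m c. True} = (UNIV :: 'a :: real_normed_field ell2 set)"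
proof -
  have "x \<in> closure {ell2_finite_sum m c | m c. True}" for x :: "'a ell2"
  proof (rule closure_sequential[THEN iffD2], intro exI conjI allI)
    show "(\<lambda>m. ell2_finite_sum m (ell2_nth x)) \<longlonglongrightarrow> x"
      by (rule ell2_truncation_tendsto)
    show "ell2_finite_sum n (ell2_nth x) \<in> {ell2_finite_sum m c | m c. True}" for n
      by blast
  qed
  then show ?thesis by blast
qed

lemma bounded_linear_funpow:
  fixes T :: "'v :: real_normed_vector \<Rightarrow> 'v"
  assumes "bounded_linear T"
  shows "bounded_linear (T ^^ n)"
proof (induction n)
  case 0
  show ?case by (simp add: id_def)
next
  case (Suc n)
  show ?case
    using bounded_linear_compose[OF assms Suc.IH] by (simp add: o_def)
qed

text \<open>Kitai's criterion: \<open>S v\<close> is a null sequence of approximate preimages of \<open>v\<close> under the powers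
  of \<open>T\<close>, so for large \<open>n\<close> the point \<open>u + S v n\<close> lies near \<open>u\<close> while its image under \<open>T ^^ n\<close>
  lies near \<open>v\<close>. The images thus meet \<open>V\<close> itself, which lies in its \<open>\<delta>\<close>-neighbourhood.\<close>

lemma kitai_criterion:
  fixes T :: "'v :: real_normed_vector \<Rightarrow> 'v"
  assumes T: "bounded_linear T" and "\<delta> > 0"
    and D: "closure D = UNIV"
    and orbit: "\<And>u. u \<in> D \<Longrightarrow> (\<lambda>n. (T ^^ n) u) \<longlonglongrightarrow> 0"
    and small: "\<And>v. v \<in> D \<Longrightarrow> S v \<longlonglongrightarrow> 0"
    and preimage: "\<And>v. v \<in> D \<Longrightarrow> (\<lambda>n. (T ^^ n) (S v n)) \<longlonglongrightarrow> v"
  shows "delta_topologically_mixing \<delta> T"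
  unfolding delta_topologically_mixing_def
proof (intro conjI allI impI)
  show "continuous_on UNIV T"
    using T by (simp add: bounded_linear.linear linear_continuous_on)
next
  fix U V :: "'v set"
  assume UV: "open U \<and> U \<noteq> {} \<and> open V \<and> V \<noteq> {}"
  have "\<exists>u. u \<in> D \<inter> W" if "open W" "W \<noteq> {}" for W
    using open_Int_closure_eq_empty[OF that(1), of D] that(2) D by auto
  with UV obtain u v where u: "u \<in> D" "u \<in> U" and v: "v \<in> D" "v \<in> V"
    by (meson IntE)
  have "(\<lambda>n. u + S v n) \<longlonglongrightarrow> u + 0"
    by (intro tendsto_intros small v)
  then have in_U: "\<forall>\<^sub>F n in sequentially. u + S v n \<in> U"
    using UV u by (auto dest: topological_tendstoD)
  have "(\<lambda>n. (T ^^ n) u + (T ^^ n) (S v n)) \<longlonglongrightarrow> 0 + v"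
    by (intro tendsto_intros orbit preimage u v)
  then have "(\<lambda>n. (T ^^ n) (u + S v n)) \<longlonglongrightarrow> v"
    by (simp add: linear_add[OF bounded_linear.linear[OF bounded_linear_funpow[OF T]]])
  then have in_V: "\<forall>\<^sub>F n in sequentially. (T ^^ n) (u + S v n) \<in> V"
    using UV v by (auto dest: topological_tendstoD)
  obtain N where N: "\<And>n. n \<ge> N \<Longrightarrow> u + S v n \<in> U \<and> (T ^^ n) (u + S v n) \<in> V"
    using eventually_conj[OF in_U in_V] by (auto simp: eventually_sequentially)
  have "V \<subseteq> set_nbhd \<delta> V"
    using \<open>\<delta> > 0\<close> by (auto simp: set_nbhd_def)
  with N show "\<exists>N. \<forall>n\<ge>N. (T ^^ n) ` U \<inter> set_nbhd \<delta> V \<noteq> {}"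
    by (intro exI[of _ N]) blast
qed

lemma weighted_backward_shift_bounded_linear:
  "weighted_backward_shift a T \<Longrightarrow> bounded_linear T"
  by (simp add: weighted_backward_shift_def)

lemma weighted_backward_shift_funpow_scale:
  assumes "weighted_backward_shift a T"
  shows "(T ^^ n) (ell2_scale c x) = ell2_scale c ((T ^^ n) x)"
  using assms by (induction n) (simp_all add: weighted_backward_shift_def)

lemma weighted_backward_shift_funpow_basis_eq_0:
  assumes T: "weighted_backward_shift a T" and "k < n"
  shows "(T ^^ n) (ell2_basis k) = 0"
  using \<open>k < n\<close>
proof (induction n arbitrary: k)
  case 0
  then show ?case by simp
next
  case (Suc n)
  have T0: "(T ^^ n) 0 = 0"
    using T by (intro linear_0 bounded_linear.linear bounded_linear_funpow
        weighted_backward_shift_bounded_linear)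
  show ?case
  proof (cases k)
    case 0
    then show ?thesis
      using T T0 by (simp add: funpow_swap1 weighted_backward_shift_def)
  next
    case (Suc l)
    then have "T (ell2_basis k) = ell2_scale (a k) (ell2_basis l)"
      using T by (simp add: weighted_backward_shift_def)
    then show ?thesis
      using Suc.IH[of l] Suc.prems Suc
      by (simp add: funpow_swap1 weighted_backward_shift_funpow_scale[OF T])
  qed
qed

lemma weighted_backward_shift_funpow_basis:
  assumes T: "weighted_backward_shift a T"
  shows "(T ^^ n) (ell2_basis (j + n))
       = ell2_scale ((\<Prod>i=1..j+n. a i) / (\<Prod>i=1..j. a i)) (ell2_basis j)"
proof (induction n)
  case 0
  have "(\<Prod>i=1..j. a i) \<noteq> 0"
    using T by (simp add: weighted_backward_shift_def)
  then show ?case by simp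
next
  case (Suc n)
  have "T (ell2_basis (j + Suc n)) = ell2_scale (a (j + Suc n)) (ell2_basis (j + n))"
    using T by (simp add: weighted_backward_shift_def)
  then show ?case
    using Suc.IH
    by (simp add: funpow_swap1 weighted_backward_shift_funpow_scale[OF T] ell2_scale_scale
        mult.commute)
qed

theorem proposition4p3:
  fixes a :: "nat \<Rightarrow> 'a :: real_normed_field" and T :: "'a ell2 \<Rightarrow> 'a ell2" and \<delta> :: real
  assumes "weighted_backward_shift a T"
    and "\<delta> > 0"
    and "filterlim (\<lambda>n. \<Prod>i=1..n. norm (a i)) at_top sequentially"
  shows "delta_topologically_mixing \<delta> T"
proof -
  note T = assms(1)
  define W where "W n = (\<Prod>i=1..n. a i)" for n
  define D :: "'a ell2 set" where "D = {ell2_finite_sum m c | m c. True}"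
  have W_nonzero: "W n \<noteq> 0" for n
    using T by (simp add: W_def weighted_backward_shift_def)
  have norm_W: "filterlim (\<lambda>n. norm (W n)) at_top sequentially"
    using assms(3) by (simp add: W_def prod_norm)
  have linear_pow: "linear (T ^^ n)" for n
    using T by (intro bounded_linear.linear bounded_linear_funpow
        weighted_backward_shift_bounded_linear)
  have orbit: "(\<lambda>n. (T ^^ n) u) \<longlonglongrightarrow> 0" if "u \<in> D" for u
  proof -
    from that obtain m c where u: "u = ell2_finite_sum m c"
      by (auto simp: D_def)
    have "(T ^^ n) u = 0" if "n \<ge> m" for n
      using that
      by (auto simp: u ell2_finite_sum_def linear_sum[OF linear_pow]
          weighted_backward_shift_funpow_scale[OF T]
          weighted_backward_shift_funpow_basis_eq_0[OF T] intro!: sum.neutral)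
    then show ?thesis
      by (intro tendsto_eventually) (auto simp: eventually_sequentially)
  qed
  have "\<exists>s. s \<longlonglongrightarrow> 0 \<and> (\<forall>n. (T ^^ n) (s n) = v)" if "v \<in> D" for v
  proof -
    from that obtain m c where v: "v = ell2_finite_sum m c"
      by (auto simp: D_def)
    \<comment> \<open>the preimages of the basis vectors, combined with the coefficients of \<open>v\<close>\<close>
    define s where "s n = (\<Sum>j<m. ell2_scale (c j * (W j / W (j + n))) (ell2_basis (j + n)))" for n
    have pow_basis: "(T ^^ n) (ell2_basis (j + n)) = ell2_scale (W (j + n) / W j) (ell2_basis j)"
      for j n
      unfolding W_def by (rule weighted_backward_shift_funpow_basis[OF T])
    have "(T ^^ n) (s n) = v" for n
      by (simp add: s_def v ell2_finite_sum_def linear_sum[OF linear_pow] pow_basis W_nonzero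
          weighted_backward_shift_funpow_scale[OF T] ell2_scale_scale)
    moreover have "(\<lambda>n. ell2_scale (c j * (W j / W (j + n))) (ell2_basis (j + n))) \<longlonglongrightarrow> 0" for j
    proof (rule tendsto_norm_zero_cancel)
      have "filterlim (\<lambda>n. norm (W (n + j))) at_top sequentially"
        by (rule filterlim_compose[OF norm_W filterlim_add_const_nat_at_top])
      then have "(\<lambda>n. norm (c j * W j) / norm (W (j + n))) \<longlonglongrightarrow> 0"
        by (intro real_tendsto_divide_at_top[OF tendsto_const]) (simp add: add.commute)
      then show "(\<lambda>n. norm (ell2_scale (c j * (W j / W (j + n))) (ell2_basis (j + n)))) \<longlonglongrightarrow> 0"
        by (simp add: norm_ell2_scale norm_mult norm_divide)
    qed
    then have "s \<longlonglongrightarrow> 0"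
      unfolding s_def by (intro tendsto_null_sum)
    ultimately show ?thesis by blast
  qed
  then obtain S where "\<And>v. v \<in> D \<Longrightarrow> S v \<longlonglongrightarrow> 0" "\<And>v n. v \<in> D \<Longrightarrow> (T ^^ n) (S v n) = v"
    by metis
  then show ?thesis
    using orbit closure_finitely_supported
    by (intro kitai_criterion[of T \<delta> D S] weighted_backward_shift_bounded_linear[OF T] \<open>\<delta> > 0\<close>)
      (simp_all add: D_def)
qed

end
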